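(* Let $p = 2(2^{1/3}-1)^2$ and $a = 2(2^{2/3}-1)^{1/2}$. Then $$\frac{\varphi(e^{-9\pi\sqrt3})}{\varphi(e^{-3\pi\sqrt3})} = 3^{-5/4}\Bigg(1 + \Big(p\frac{1-a\sin\frac{\pi}{9}}{1-a\sin\frac{2\pi}{9}}\Big)^{1/3} + \Big(p\frac{1+a\sin\frac{4\pi}{9}}{1-a\sin\frac{\pi}{9}}\Big)^{1/3} + (2^{2/3}-2^{1/3}) + \Big(p\frac{1-a\sin\frac{2\pi}{9}}{1+a\sin\frac{4\pi}{9}}\Big)^{1/3}\Bigg).$$
   Context: $\varphi(q) := \sum_{n=-\infty}^\infty q^{n^2}$ for $|q|<1$. Roots of positive reals are the positive real roots; cube roots are real. *)

theory Defs
  imports "HOL-Analysis.Analysis"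
begin

text \<open>Meaningful for \<open>norm q < 1\<close>, where the series converges absolutely.\<close>

definition ramanujan_phi :: "'a::{real_normed_field,banach} \<Rightarrow> 'a"  ("\<phi>")
  where "\<phi> q = (\<Sum>\<^sub>\<infinity>n\<in>(UNIV::int set). q powi (n\<^sup>2))"

end

theory Submission
  imports Defs "HOL-Probability.Characteristic_Functions"
begin

text \<open>
  Write \<open>h t = \<phi> (exp (- pi * t))\<close>. The inversion \<open>h (1/t) = sqrt t * h t\<close> and the cubic relation
  \<open>(h t - h (9t))\<^sup>3 h (9t) = h (3t)\<^sup>4 - h (9t)\<^sup>4\<close>, used at \<open>t = 1/(3 sqrt 3)\<close> and \<open>t = 1/(9 sqrt 3)\<close>,
  determine the quotient: with \<open>c\<^sup>3 = 2\<close> it is \<open>3 powr (-5/4) * (1 - c + c\<^sup>2) * (1 + root 3 (2/(c - 1)))\<close>.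
  It remains to denest the radicals of the theorem. The numbers \<open>a * sin (pi/9)\<close>, \<open>a * sin (2pi/9)\<close>,
  \<open>- a * sin (4pi/9)\<close> are the roots of \<open>z\<^sup>3 - 3(c\<^sup>2 - 1)z + 3(c - 1)\<close>, whose splitting field is cyclic
  cubic over \<open>\<rat>(c)\<close>, and in that field each quotient \<open>(1 - z)/(1 - z')\<close> of consecutive roots is
  a cube.
\<close>

section \<open>Denesting the radicals\<close>

lemma sin_trisection:
  fixes \<theta> :: real
  assumes "sin (3 * \<theta>) = sqrt 3 / 2" "cos (3 * \<theta>) = 1 / 2"
  shows "4 * sin \<theta> ^ 3 - 3 * sin \<theta> + sqrt 3 / 2 = 0"
    and "sin (\<theta> + 2 * pi / 3) = sqrt 3 - 2 * sin \<theta> - 2 * sqrt 3 * (sin \<theta>)\<^sup>2"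
proof -
  have sq: "(cos \<theta>)\<^sup>2 = 1 - (sin \<theta>)\<^sup>2"
    by (simp add: cos_squared_eq)
  have "sin (3 * \<theta>) = sin (2 * \<theta> + \<theta>)" by (simp add: algebra_simps)
  also have "\<dots> = 2 * sin \<theta> * (cos \<theta>)\<^sup>2 + (1 - 2 * (sin \<theta>)\<^sup>2) * sin \<theta>"
    unfolding sin_add sin_double cos_double_sin by (simp add: power2_eq_square)
  also have "\<dots> = 3 * sin \<theta> - 4 * sin \<theta> ^ 3"
    unfolding sq by (simp add: algebra_simps power2_eq_square power3_eq_cube)
  finally show "4 * sin \<theta> ^ 3 - 3 * sin \<theta> + sqrt 3 / 2 = 0"
    using assms(1) by linarith
  have "cos (2 * \<theta>) = cos (3 * \<theta> - \<theta>)" by simp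
  also have "\<dots> = cos \<theta> / 2 + sqrt 3 / 2 * sin \<theta>"
    unfolding cos_diff assms by simp
  finally have "cos \<theta> = 2 * (1 - 2 * (sin \<theta>)\<^sup>2) - sqrt 3 * sin \<theta>"
    unfolding cos_double_sin by simp
  moreover have "sin (\<theta> + 2 * pi / 3) = - sin \<theta> / 2 + sqrt 3 / 2 * cos \<theta>"
    using sin_120 cos_120 by (simp add: sin_add)
  ultimately have "sin (\<theta> + 2 * pi / 3) = - sin \<theta> / 2
      + sqrt 3 / 2 * (2 * (1 - 2 * (sin \<theta>)\<^sup>2) - sqrt 3 * sin \<theta>)"
    by simp
  also have "\<dots> = sqrt 3 - (1 / 2 + sqrt 3 * sqrt 3 / 2) * sin \<theta> - 2 * sqrt 3 * (sin \<theta>)\<^sup>2"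
    by algebra
  finally show "sin (\<theta> + 2 * pi / 3) = sqrt 3 - 2 * sin \<theta> - 2 * sqrt 3 * (sin \<theta>)\<^sup>2"
    by simp
qed

text \<open>
  The map \<open>z \<mapsto> z'\<close> generates the Galois group of the cubic. The coefficients of \<open>v\<close> were found numerically,
  by interpolating the real cube roots of \<open>(1 - z)/(1 - z')\<close> at the three roots.
\<close>

lemma cube_of_cubic_element:
  fixes c z z' v :: real
  assumes "c ^ 3 = 2"
    and "z ^ 3 - 3 * (c\<^sup>2 - 1) * z + 3 * (c - 1) = 0"
    and "z' = 2 - 2 * c + 2 * c\<^sup>2 - 2 * z - (1 + c) * z\<^sup>2"
    and "3 * v = 3 * (1 + c)\<^sup>2 - (2 + c + 2 * c\<^sup>2) * z - (3 + 2 * c + 2 * c\<^sup>2) * z\<^sup>2"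
  shows "v ^ 3 * (1 - z') = 1 - z"
proof -
  have c: "c * (c * c) = 2" and c': "\<And>x. c * (c * (c * x)) = 2 * x"
    using assms(1) by (simp_all add: power3_eq_cube mult.assoc[symmetric])
  have z: "z * (z * z) = 3 * (c * c - 1) * z - 3 * (c - 1)"
    using assms(2) by (simp add: power2_eq_square power3_eq_cube mult.assoc)
  have z': "z * (z * (z * x)) = (3 * (c * c - 1) * z - 3 * (c - 1)) * x" for x
    unfolding z[symmetric] by (simp only: mult.assoc)
  note red = algebra_simps power2_eq_square c c' z z'
  have v2: "(3 * v)\<^sup>2 = 45 + 36 * c + 36 * c\<^sup>2 - (21 + 15 * c + 12 * c\<^sup>2) * z
      - (33 + 24 * c + 18 * c\<^sup>2) * z\<^sup>2"
    unfolding assms(4) by (simp add: red)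
  have "(3 * v) ^ 3 = (3 * v) * (3 * v)\<^sup>2"
    by (simp add: power3_eq_cube power2_eq_square)
  also have "\<dots> = 486 + 351 * c + 297 * c\<^sup>2 - (189 + 135 * c + 108 * c\<^sup>2) * z
      - (297 + 243 * c + 189 * c\<^sup>2) * z\<^sup>2"
    unfolding v2 unfolding assms(4) by (simp add: red)
  finally have v3: "(3 * v) ^ 3 = \<dots>" .
  have "(3 * v) ^ 3 * (1 - z') = 27 * (1 - z)"
    unfolding v3 unfolding assms(3) by (simp add: red)
  thus ?thesis by (simp add: power_mult_distrib)
qed

lemma sum_cube_roots_unit_ratios:
  fixes c a p :: real
  assumes c3: "c ^ 3 = 2" and a: "a = 2 * sqrt (c\<^sup>2 - 1)" and p: "p = 2 * (c - 1)\<^sup>2"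
  shows "root 3 (p * ((1 - a * sin (pi/9)) / (1 - a * sin (2*pi/9))))
      + root 3 (p * ((1 + a * sin (4*pi/9)) / (1 - a * sin (pi/9))))
      + root 3 (p * ((1 - a * sin (2*pi/9)) / (1 + a * sin (4*pi/9))))
    = (1 - c + c\<^sup>2) * root 3 (2 / (c - 1))"
proof -
  have c1: "c > 1"
  proof (rule ccontr)
    assume "\<not> c > 1"
    hence "c ^ 3 \<le> 1 ^ 3" by (intro power_mono_odd) auto
    with c3 show False by simp
  qed
  hence c2: "c\<^sup>2 > 1" by (simp add: one_less_power)
  have cc: "c * (c * c) = 2" and cc': "\<And>x. c * (c * (c * x)) = 2 * x"
    using c3 by (simp_all add: power3_eq_cube mult.assoc[symmetric])
  note red = algebra_simps power2_eq_square power3_eq_cube power4_eq_xxxx cc cc'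
    add_divide_distrib diff_divide_distrib
  have a2: "a\<^sup>2 = 4 * (c\<^sup>2 - 1)"
    using c2 by (simp add: a power_mult_distrib)
  have a3: "a * sqrt 3 = 2 * (c - 1) * (1 + c)\<^sup>2"
  proof -
    have "a * sqrt 3 = 2 * sqrt (3 * (c\<^sup>2 - 1))"
      unfolding a real_sqrt_mult by simp
    also have "3 * (c\<^sup>2 - 1) = ((c - 1) * (1 + c)\<^sup>2)\<^sup>2"
      by (simp add: red)
    also have "sqrt \<dots> = (c - 1) * (1 + c)\<^sup>2"
      using c1 by simp
    finally show ?thesis by simp
  qed

  define z where "z \<theta> = a * sin \<theta>" for \<theta>
  define v where "v \<theta> = (1 + c)\<^sup>2 - (2 + c + 2 * c\<^sup>2) / 3 * z \<theta>
    - (3 + 2 * c + 2 * c\<^sup>2) / 3 * (z \<theta>)\<^sup>2" for \<theta>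
  have cubic: "z \<theta> ^ 3 - 3 * (c\<^sup>2 - 1) * z \<theta> + 3 * (c - 1) = 0"
    and step: "z (\<theta> + 2 * pi / 3) = 2 - 2 * c + 2 * c\<^sup>2 - 2 * z \<theta> - (1 + c) * (z \<theta>)\<^sup>2"
    and unit: "v \<theta> ^ 3 * (1 - z (\<theta> + 2 * pi / 3)) = 1 - z \<theta>"
    if "sin (3 * \<theta>) = sqrt 3 / 2" "cos (3 * \<theta>) = 1 / 2" for \<theta>
  proof -
    have s3: "4 * sin \<theta> ^ 3 = 3 * sin \<theta> - sqrt 3 / 2"
      using sin_trisection(1)[OF that] by simp
    have "4 * z \<theta> ^ 3 = a\<^sup>2 * a * (4 * sin \<theta> ^ 3)"
      by (simp add: z_def power_mult_distrib power2_eq_square power3_eq_cube)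
    also have "\<dots> = a\<^sup>2 * (3 * z \<theta> - a * sqrt 3 / 2)"
      unfolding s3 z_def by (simp add: algebra_simps)
    also have "\<dots> = 12 * (c\<^sup>2 - 1) * z \<theta> - 12 * (c - 1)"
      unfolding a2 a3 by (simp add: red)
    finally show cub: "z \<theta> ^ 3 - 3 * (c\<^sup>2 - 1) * z \<theta> + 3 * (c - 1) = 0"
      by (simp add: algebra_simps)
    have "z (\<theta> + 2 * pi / 3) = a * sqrt 3 - 2 * z \<theta> - 2 * (a * sqrt 3) * (sin \<theta>)\<^sup>2"
      unfolding z_def sin_trisection(2)[OF that] by (simp add: algebra_simps)
    also have "a * sqrt 3 = 2 - 2 * c + 2 * c\<^sup>2"
      unfolding a3 by (simp add: red)
    also have "2 * \<dots> = (1 + c) * a\<^sup>2"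
      unfolding a2 by (simp add: red)
    finally show st: "z (\<theta> + 2 * pi / 3) = 2 - 2 * c + 2 * c\<^sup>2 - 2 * z \<theta> - (1 + c) * (z \<theta>)\<^sup>2"
      by (simp add: z_def power_mult_distrib)
    show "v \<theta> ^ 3 * (1 - z (\<theta> + 2 * pi / 3)) = 1 - z \<theta>"
      by (rule cube_of_cubic_element[OF c3 cub st]) (simp add: v_def field_simps)
  qed

  define \<alpha> \<beta> \<gamma> where "\<alpha> = pi / 9" and "\<beta> = \<alpha> + 2 * pi / 3" and "\<gamma> = \<beta> + 2 * pi / 3"
  have \<alpha>: "sin (3 * \<alpha>) = sqrt 3 / 2" "cos (3 * \<alpha>) = 1 / 2"
    using sin_60 cos_60 by (simp_all add: \<alpha>_def)
  have "3 * \<beta> = 3 * \<alpha> + 2 * pi" "3 * \<gamma> = 3 * \<beta> + 2 * pi"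
    by (simp_all add: \<beta>_def \<gamma>_def)
  hence \<beta>: "sin (3 * \<beta>) = sqrt 3 / 2" "cos (3 * \<beta>) = 1 / 2"
    and \<gamma>: "sin (3 * \<gamma>) = sqrt 3 / 2" "cos (3 * \<gamma>) = 1 / 2"
    using \<alpha> by (simp_all only: sin_periodic cos_periodic)
  have "\<gamma> + 2 * pi / 3 = \<alpha> + 2 * pi"
    by (simp add: \<beta>_def \<gamma>_def)
  hence z\<gamma>: "z (\<gamma> + 2 * pi / 3) = z \<alpha>"
    by (simp add: z_def)
  have za: "z \<alpha> = a * sin (pi/9)" by (simp add: z_def \<alpha>_def)
  have "\<beta> = pi - 2 * pi / 9" by (simp add: \<alpha>_def \<beta>_def field_simps)
  hence "sin \<beta> = sin (2*pi/9)" by (simp only: sin_pi_minus)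
  hence zb: "z \<beta> = a * sin (2*pi/9)" by (simp add: z_def)
  have "\<gamma> = 4 * pi / 9 + pi" by (simp add: \<alpha>_def \<beta>_def \<gamma>_def field_simps)
  hence "sin \<gamma> = - sin (4*pi/9)" by (simp only: sin_periodic_pi)
  hence zc: "z \<gamma> = - (a * sin (4*pi/9))" by (simp add: z_def)

  have u\<alpha>: "v \<alpha> ^ 3 * (1 - z \<beta>) = 1 - z \<alpha>" and u\<beta>: "v \<beta> ^ 3 * (1 - z \<gamma>) = 1 - z \<beta>"
    and u\<gamma>: "v \<gamma> ^ 3 * (1 - z \<alpha>) = 1 - z \<gamma>"
    using unit[OF \<alpha>] unit[OF \<beta>] unit[OF \<gamma>] z\<gamma> by (simp_all add: \<beta>_def \<gamma>_def)
  have "z \<alpha> \<noteq> 1"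
  proof
    assume "z \<alpha> = 1"
    with cubic[OF \<alpha>] have "3 * c\<^sup>2 = 3 * c + 1" by (simp add: algebra_simps)
    hence e: "3 * (c * c) = 3 * c + 1" unfolding power2_eq_square .
    have "6 = 3 * (c * c) * c" using cc by simp
    also have "\<dots> = 3 * (c * c) + c" by (subst e) (simp add: algebra_simps)
    also have "\<dots> = 4 * c + 1" unfolding e by simp
    finally have "c = 5 / 4" by simp
    with c3 show False by (simp add: power3_eq_cube)
  qed
  hence nz: "1 - z \<alpha> \<noteq> 0" "1 - z \<beta> \<noteq> 0" "1 - z \<gamma> \<noteq> 0"
    using u\<alpha> u\<beta> by auto

  define g where "g = root 3 (2 / (c - 1))"
  have g3: "g ^ 3 * (c - 1) = 2"
    using c1 by (simp add: g_def field_simps)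
  have rt: "root 3 (p * (x / y)) = g * (c - 1) * w" if "w ^ 3 * y = x" "y \<noteq> 0" for w x y
  proof -
    have "(g * (c - 1) * w) ^ 3 = (g ^ 3 * (c - 1)) * (c - 1)\<^sup>2 * w ^ 3"
      by (simp add: power2_eq_square power3_eq_cube)
    also have "w ^ 3 = x / y" using that by (simp add: field_simps)
    finally have "p * (x / y) = (g * (c - 1) * w) ^ 3"
      by (simp add: g3 p)
    thus ?thesis by (simp add: odd_real_root_power_cancel)
  qed
  have sum: "v \<alpha> + v \<beta> + v \<gamma> = (1 + c)\<^sup>2"
  proof -
    have rot: "sin (x + 2 * pi / 3) = - sin x / 2 + sqrt 3 / 2 * cos x"
      "cos (x + 2 * pi / 3) = - cos x / 2 - sqrt 3 / 2 * sin x" for x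
      unfolding sin_add[of _ "2 * pi / 3"] cos_add[of _ "2 * pi / 3"] sin_120 cos_120 by simp_all
    note r = rot(1)[of \<alpha>, folded \<beta>_def] rot(2)[of \<alpha>, folded \<beta>_def]
      rot(1)[of \<beta>, folded \<gamma>_def]
    have "sin \<alpha> + sin \<beta> + sin \<gamma> = 0"
      unfolding r(3) unfolding r(1,2) by (simp add: algebra_simps add_divide_distrib diff_divide_distrib)
    hence s1: "z \<alpha> + z \<beta> + z \<gamma> = 0"
      by (simp add: z_def distrib_left[symmetric])
    let ?T = "\<lambda>x. 2 - 2 * c + 2 * c\<^sup>2 - 2 * x - (1 + c) * x\<^sup>2"
    have "z \<beta> + z \<gamma> + z \<alpha> = ?T (z \<alpha>) + ?T (z \<beta>) + ?T (z \<gamma>)"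
      by (intro arg_cong2[where f = "(+)"] step[OF \<alpha>, folded \<beta>_def]
          step[OF \<beta>, folded \<gamma>_def] step[OF \<gamma>, unfolded z\<gamma>])
    also have "\<dots> = 3 * (2 - 2 * c + 2 * c\<^sup>2) - 2 * (z \<alpha> + z \<beta> + z \<gamma>)
        - (1 + c) * ((z \<alpha>)\<^sup>2 + (z \<beta>)\<^sup>2 + (z \<gamma>)\<^sup>2)"
      by (simp add: algebra_simps)
    finally have "(1 + c) * ((z \<alpha>)\<^sup>2 + (z \<beta>)\<^sup>2 + (z \<gamma>)\<^sup>2) = 6 - 6 * c + 6 * c\<^sup>2"
      using s1 by simp
    also have "\<dots> = (1 + c) * (6 * (c\<^sup>2 - 1))"
      by (simp add: red)
    finally have s2: "(z \<alpha>)\<^sup>2 + (z \<beta>)\<^sup>2 + (z \<gamma>)\<^sup>2 = 6 * (c\<^sup>2 - 1)"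
      using c1 by simp
    have "v \<alpha> + v \<beta> + v \<gamma> = 3 * (1 + c)\<^sup>2 - (2 + c + 2 * c\<^sup>2) / 3 * (z \<alpha> + z \<beta> + z \<gamma>)
        - (3 + 2 * c + 2 * c\<^sup>2) / 3 * ((z \<alpha>)\<^sup>2 + (z \<beta>)\<^sup>2 + (z \<gamma>)\<^sup>2)"
      unfolding v_def by algebra
    also have "\<dots> = (1 + c)\<^sup>2"
      unfolding s1 s2 by (simp add: red)
    finally show ?thesis .
  qed
  have "root 3 (p * ((1 - z \<alpha>) / (1 - z \<beta>))) + root 3 (p * ((1 - z \<gamma>) / (1 - z \<alpha>)))
      + root 3 (p * ((1 - z \<beta>) / (1 - z \<gamma>))) = g * (c - 1) * (v \<alpha> + v \<beta> + v \<gamma>)"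
    unfolding rt[OF u\<alpha> nz(2)] rt[OF u\<beta> nz(3)] rt[OF u\<gamma> nz(1)] by (simp add: algebra_simps)
  also have "\<dots> = (1 - c + c\<^sup>2) * g"
    unfolding sum by (simp add: red)
  finally show ?thesis by (simp add: za zb zc g_def)
qed

section \<open>The cubic relation\<close>

lemma summable_on_powi_square:
  fixes q :: real
  assumes "0 < q" "q < 1"
  shows "(\<lambda>n::int. q powi n\<^sup>2) summable_on UNIV"
proof (rule summable_on_comparison_test)
  have geo: "(\<lambda>n::nat. q ^ n) summable_on UNIV"
    by (rule summable_nonneg_imp_summable_on) (use assms in auto)
  have "(\<lambda>n::int. q ^ nat \<bar>n\<bar>) summable_on {0..}"
    using geo by (subst summable_on_reindex_bij_witness[of _ int nat UNIV "\<lambda>n. q ^ n"]) auto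
  moreover have "(\<lambda>n::int. q ^ nat \<bar>n\<bar>) summable_on {..0}"
    using geo by (subst summable_on_reindex_bij_witness[of _ "\<lambda>n. - int n" "\<lambda>n. nat (- n)" UNIV "\<lambda>n. q ^ n"]) auto
  ultimately have "(\<lambda>n::int. q ^ nat \<bar>n\<bar>) summable_on ({0..} \<union> {..0})"
    by (rule summable_on_union)
  also have "{0..} \<union> {..0} = (UNIV :: int set)" by auto
  finally show "(\<lambda>n::int. q ^ nat \<bar>n\<bar>) summable_on UNIV" .
next
  fix n :: int
  have "\<bar>n\<bar> * 1 \<le> \<bar>n\<bar> * \<bar>n\<bar>"
    by (cases "n = 0") (simp, intro mult_left_mono, simp_all)
  hence "nat \<bar>n\<bar> \<le> nat (n\<^sup>2)"
    by (intro nat_mono) (simp only: power2_eq_square abs_mult_self_eq mult_1_right)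
  thus "q powi n\<^sup>2 \<le> q ^ nat \<bar>n\<bar>"
    using assms by (simp add: power_int_def power_decreasing)
  show "0 \<le> q powi n\<^sup>2" using assms by simp
qed

lemma has_sum_ramanujan_phi:
  fixes q :: real
  assumes "0 < q" "q < 1"
  shows "((\<lambda>n::int. q powi n\<^sup>2) has_sum \<phi> q) UNIV"
  unfolding ramanujan_phi_def using summable_on_powi_square[OF assms] by simp

lemma has_sum_Times_mult:
  fixes f :: "'a \<Rightarrow> real" and g :: "'b \<Rightarrow> real"
  assumes f: "(f has_sum s) A" and g: "(g has_sum t) B"
  shows "((\<lambda>(x, y). f x * g y) has_sum s * t) (A \<times> B)"
proof (rule has_sum_SigmaI)
  show "((\<lambda>y. case (x, y) of (x, y) \<Rightarrow> f x * g y) has_sum f x * t) B" for x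
    using has_sum_cmult_right[OF g] by simp
  show "((\<lambda>x. f x * t) has_sum s * t) A"
    by (rule has_sum_cmult_left[OF f])
  have "(\<lambda>(x, y). \<bar>f x\<bar> * \<bar>g y\<bar>) summable_on A \<times> B"
  proof (rule summable_on_SigmaI)
    have "(\<lambda>x. \<bar>f x\<bar>) summable_on A" and gs: "(\<lambda>y. \<bar>g y\<bar>) summable_on B"
      using f g summable_on_iff_abs_summable_on_real[of f A]
        summable_on_iff_abs_summable_on_real[of g B] by (auto simp: has_sum_iff)
    thus "(\<lambda>x. \<bar>f x\<bar> * infsum (\<lambda>y. \<bar>g y\<bar>) B) summable_on A"
      by (intro summable_on_cmult_left)
    show "((\<lambda>y. case (x, y) of (x, y) \<Rightarrow> \<bar>f x\<bar> * \<bar>g y\<bar>) has_sum \<bar>f x\<bar> * infsum (\<lambda>y. \<bar>g y\<bar>) B) B" for x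
      using has_sum_cmult_right[OF has_sum_infsum[OF gs]] by simp
  qed auto
  thus "(\<lambda>(x, y). f x * g y) summable_on A \<times> B"
    by (subst summable_on_iff_abs_summable_on_real) (simp add: case_prod_unfold abs_mult)
qed

lemma has_sum_mult_mod_3:
  fixes f g :: "int \<Rightarrow> real"
  assumes "(f has_sum s0) {n. n mod 3 = 0}" "(f has_sum s1) {n. n mod 3 = 1}" "(f has_sum s2) {n. n mod 3 = 2}"
    and g: "\<And>n. n mod 3 = 0 \<Longrightarrow> g n = g0" "\<And>n. n mod 3 = 1 \<Longrightarrow> g n = g1" "\<And>n. n mod 3 = 2 \<Longrightarrow> g n = g2"
  shows "((\<lambda>n. f n * g n) has_sum (s0 * g0 + s1 * g1 + s2 * g2)) UNIV"
proof -
  have *: "((\<lambda>n. f n * g n) has_sum s * c) B" if "(f has_sum s) B" "\<And>n. n \<in> B \<Longrightarrow> g n = c" for s c B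
    using has_sum_cmult_left[OF that(1), of c] by (rule has_sum_cong[THEN iffD1, rotated]) (simp add: that(2))
  have "((\<lambda>n. f n * g n) has_sum s0 * g0) {n. n mod 3 = 0}"
    "((\<lambda>n. f n * g n) has_sum s1 * g1) {n. n mod 3 = 1}"
    "((\<lambda>n. f n * g n) has_sum s2 * g2) {n. n mod 3 = 2}"
    by (rule *, fact, simp add: g)+
  from has_sum_Un_disjoint[OF has_sum_Un_disjoint[OF this(1,2)] this(3)]
  have "((\<lambda>n. f n * g n) has_sum s0 * g0 + s1 * g1 + s2 * g2)
      ({n. n mod 3 = 0} \<union> {n. n mod 3 = 1} \<union> {n. n mod 3 = 2})"
    by (auto simp: disjoint_iff)
  also have "{n. n mod 3 = 0} \<union> {n. n mod 3 = 1} \<union> {n. n mod 3 = 2} = (UNIV :: int set)"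
  proof -
    have "n mod 3 = 0 \<or> n mod 3 = 1 \<or> n mod 3 = 2" for n :: int by presburger
    thus ?thesis by blast
  qed
  finally show ?thesis .
qed

text \<open>
  The matrix with rows \<open>(0,1,1,1)\<close>, \<open>(1,0,1,-1)\<close>, \<open>(1,-1,0,1)\<close>, \<open>(1,1,-1,0)\<close> is \<open>sqrt 3\<close> times an orthogonal
  matrix. It maps \<open>\<int>\<^sup>4\<close> onto the lattice of vectors whose residues modulo 3 form a codeword of the
  tetracode, with weight enumerator \<open>x\<^sup>4 + 8xy\<^sup>3\<close>. Comparing theta series proves the relation.
\<close>

lemma ramanujan_phi_cubic:
  fixes q :: real
  assumes q: "0 < q" "q < 1"
  shows "\<phi> (q ^ 3) ^ 4 = \<phi> (q ^ 9) ^ 4 + \<phi> (q ^ 9) * (\<phi> q - \<phi> (q ^ 9)) ^ 3"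
proof -
  define f where "f = (\<lambda>n::int. q powi n\<^sup>2)"
  define A where "A = \<phi> (q ^ 9)"
  define b where "b = infsum f {n. n mod 3 = 1}"
  define R where "R r = {n :: int. n mod 3 = r mod 3}" for r
  define T where "T r = (if r mod 3 = 0 then A else b)" for r :: int
  have pow: "0 < q ^ k" "q ^ k < 1" if "k > 0" for k
    using q that by (simp_all add: power_less_one_iff)
  have powi: "(q ^ k) powi m = q powi (int k * m)" for k m
    by (simp add: power_int_mult)
  have f: "f summable_on B" for B
    unfolding f_def by (rule summable_on_subset[OF summable_on_powi_square[OF q]]) auto
  have f0: "(f has_sum A) {n. n mod 3 = 0}"
  proof -
    have "((\<lambda>n::int. (q ^ 9) powi n\<^sup>2) has_sum A) UNIV"
      unfolding A_def using pow[of 9] by (intro has_sum_ramanujan_phi) simp_all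
    thus ?thesis
      by (subst has_sum_reindex_bij_witness[of _ "\<lambda>n. 3 * n" "\<lambda>n. n div 3" UNIV "\<lambda>n. (q ^ 9) powi n\<^sup>2" _ A A])
         (auto simp: f_def powi power_mult_distrib)
  qed
  have f1: "(f has_sum b) {n. n mod 3 = 1}"
    using f by (simp add: b_def)
  hence f2: "(f has_sum b) {n. n mod 3 = 2}"
    by (subst has_sum_reindex_bij_witness[of _ uminus uminus "{n. n mod 3 = 1}" f _ b b])
       (auto simp: f_def, presburger+)
  have \<phi>q: "\<phi> q = A + 2 * b"
  proof -
    have "(f has_sum (A + 2 * b)) UNIV"
      using has_sum_mult_mod_3[OF f0 f1 f2, of "\<lambda>_. 1" 1 1 1] by (simp add: algebra_simps)
    with has_sum_ramanujan_phi[OF q] show ?thesis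
      unfolding f_def by (rule has_sum_unique)
  qed
  have fR: "(f has_sum T r) (R r)" for r
  proof -
    have "r mod 3 = 0 \<or> r mod 3 = 1 \<or> r mod 3 = 2" by presburger
    then consider "r mod 3 = 0" | "r mod 3 = 1" | "r mod 3 = 2" by blast
    thus ?thesis using f0 f1 f2 by cases (simp_all add: T_def R_def)
  qed

  define g where "g = (\<lambda>n::int. (q ^ 3) powi n\<^sup>2)"
  define L where "L = Sigma (UNIV \<times> UNIV) (\<lambda>(u, v). R (v - u) \<times> R (- u - v))"
  define F where "F = (\<lambda>((u, v), (s, t)). (f u * f v) * (f s * f t))"
  have g: "(g has_sum \<phi> (q ^ 3)) UNIV"
    unfolding g_def using pow[of 3] by (intro has_sum_ramanujan_phi) simp_all
  define h where "h = (\<lambda>((u, v), (s, t)). (g u * g v) * (g s * g t))"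
  have "(h has_sum \<phi> (q ^ 3) ^ 4) UNIV"
    using has_sum_Times_mult[OF has_sum_Times_mult[OF g g] has_sum_Times_mult[OF g g]]
    by (simp add: h_def case_prod_unfold power4_eq_xxxx mult.assoc)
  moreover have "(F has_sum s) L = (h has_sum s) UNIV" for s
  proof -
    define i where "i = (\<lambda>((a, b), (c, d)). ((a + b - d, a - b + c), (b + c + d, a - c + d)) ::
      (int \<times> int) \<times> (int \<times> int))"
    define j where "j = (\<lambda>((u, v), (s, t)). let k = (s - v + u) div 3; l = (t + u + v) div 3
      in ((l, k), (v + k - l, k + l - u)) :: (int \<times> int) \<times> (int \<times> int))"
    have ij: "i (j x) = x" if "x \<in> L" for x
    proof -
      obtain u v s t where x: "x = ((u, v), (s, t))" by (metis surj_pair)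
      have "s \<in> R (v - u)" "t \<in> R (- u - v)"
        using that by (simp_all add: x L_def)
      hence "3 dvd s - (v - u)" "3 dvd t - (- u - v)"
        by (simp_all only: R_def mem_Collect_eq mod_eq_dvd_iff)
      then obtain k l where "s - (v - u) = 3 * k" "t - (- u - v) = 3 * l"
        by (elim dvdE) blast
      hence "s - v + u = 3 * k" "t + u + v = 3 * l" "s = 3 * k + v - u" "t = 3 * l - u - v"
        by linarith+
      thus ?thesis by (simp add: x i_def j_def)
    qed
    have ji: "j (i y) = y" for y
    proof -
      obtain a b c d where y: "y = ((a, b), (c, d))" by (metis surj_pair)
      have "b + c + d - (a - b + c) + (a + b - d) = 3 * b"
        "a - c + d + (a + b - d) + (a - b + c) = 3 * a" by simp_all
      thus ?thesis by (simp add: y i_def j_def)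
    qed
    have iL: "i y \<in> L" for y
    proof -
      obtain a b c d where y: "y = ((a, b), (c, d))" by (metis surj_pair)
      have "(b + c + d) mod 3 = (a - b + c - (a + b - d)) mod 3"
        unfolding mod_eq_dvd_iff by (rule dvdI[of _ _ b]) simp
      moreover have "(a - c + d) mod 3 = (- (a + b - d) - (a - b + c)) mod 3"
        unfolding mod_eq_dvd_iff by (rule dvdI[of _ _ a]) simp
      ultimately show ?thesis by (simp add: y i_def L_def R_def)
    qed
    have Fi: "F (i y) = h y" for y
    proof -
      obtain a b c d where y: "y = ((a, b), (c, d))" by (metis surj_pair)
      have "(a + b - d)\<^sup>2 + (a - b + c)\<^sup>2 + ((b + c + d)\<^sup>2 + (a - c + d)\<^sup>2)
        = 3 * a\<^sup>2 + 3 * b\<^sup>2 + (3 * c\<^sup>2 + 3 * d\<^sup>2)"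
        by (simp add: power2_eq_square algebra_simps)
      thus ?thesis
        using q by (simp add: y i_def F_def h_def f_def g_def powi power_int_add[symmetric])
    qed
    show ?thesis
      by (rule has_sum_reindex_bij_witness[of L i j]) (simp_all only: ij ji iL Fi[symmetric] UNIV_I)
  qed
  ultimately have L: "(F has_sum \<phi> (q ^ 3) ^ 4) L"
    by simp

  have "((\<lambda>(u, v). f u * f v * (T (v - u) * T (- u - v))) has_sum \<phi> (q ^ 3) ^ 4) (UNIV \<times> UNIV)"
  proof (rule has_sum_Sigma'[OF L[unfolded L_def]])
    fix uv :: "int \<times> int"
    obtain u v where uv: "uv = (u, v)" by force
    show "((\<lambda>st. F (uv, st)) has_sum (case uv of (u, v) \<Rightarrow> f u * f v * (T (v - u) * T (- u - v))))
      (case uv of (u, v) \<Rightarrow> R (v - u) \<times> R (- u - v))"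
      using has_sum_cmult_right[OF has_sum_Times_mult[OF fR fR], of "f u * f v" "v - u" "- u - v"]
      by (simp add: uv F_def case_prod_unfold)
  qed
  hence "((\<lambda>u. f u * (if u mod 3 = 0 then A ^ 3 + 2 * b ^ 3 else 3 * A * b\<^sup>2)) has_sum \<phi> (q ^ 3) ^ 4) UNIV"
  proof (rule has_sum_Sigma')
    fix u :: int
    have T: "T (v - u) = (if v mod 3 = u mod 3 then A else b)"
      "T (- u - v) = (if (u mod 3, v mod 3) \<in> {(0, 0), (1, 2), (2, 1)} then A else b)" for v
    proof -
      have "(v - u) mod 3 = 0 \<longleftrightarrow> v mod 3 = u mod 3" by presburger
      thus "T (v - u) = (if v mod 3 = u mod 3 then A else b)" by (simp add: T_def)
      have "(- u - v) mod 3 = 0 \<longleftrightarrow> u mod 3 = 0 \<and> v mod 3 = 0 \<or> u mod 3 = 1 \<and> v mod 3 = 2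
          \<or> u mod 3 = 2 \<and> v mod 3 = 1" by presburger
      thus "T (- u - v) = (if (u mod 3, v mod 3) \<in> {(0, 0), (1, 2), (2, 1)} then A else b)"
        by (simp add: T_def)
    qed
    have "((\<lambda>v. f v * (T (v - u) * T (- u - v))) has_sum
      (if u mod 3 = 0 then A ^ 3 + 2 * b ^ 3 else 3 * A * b\<^sup>2)) UNIV"
    proof -
      have "u mod 3 = 0 \<or> u mod 3 = 1 \<or> u mod 3 = 2" by presburger
      then consider "u mod 3 = 0" | "u mod 3 = 1" | "u mod 3 = 2" by blast
      thus ?thesis
      proof cases
        case 1
        have "((\<lambda>v. f v * (T (v - u) * T (- u - v))) has_sum
          (A * (A * A) + b * (b * b) + b * (b * b))) UNIV"
          by (rule has_sum_mult_mod_3[OF f0 f1 f2]) (simp_all add: T 1)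
        with 1 show ?thesis by (simp add: power3_eq_cube algebra_simps)
      next
        case 2
        have "((\<lambda>v. f v * (T (v - u) * T (- u - v))) has_sum
          (A * (b * b) + b * (A * b) + b * (b * A))) UNIV"
          by (rule has_sum_mult_mod_3[OF f0 f1 f2]) (simp_all add: T 2)
        with 2 show ?thesis by (simp add: power2_eq_square algebra_simps)
      next
        case 3
        have "((\<lambda>v. f v * (T (v - u) * T (- u - v))) has_sum
          (A * (b * b) + b * (b * A) + b * (A * b))) UNIV"
          by (rule has_sum_mult_mod_3[OF f0 f1 f2]) (simp_all add: T 3)
        with 3 show ?thesis by (simp add: power2_eq_square algebra_simps)
      qed
    qed
    from has_sum_cmult_right[OF this, of "f u"]
    show "((\<lambda>v. case (u, v) of (u, v) \<Rightarrow> f u * f v * (T (v - u) * T (- u - v))) has_sum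
      f u * (if u mod 3 = 0 then A ^ 3 + 2 * b ^ 3 else 3 * A * b\<^sup>2)) UNIV"
      by (simp add: mult.assoc)
  qed
  moreover have "((\<lambda>u. f u * (if u mod 3 = 0 then A ^ 3 + 2 * b ^ 3 else 3 * A * b\<^sup>2)) has_sum
      (A * (A ^ 3 + 2 * b ^ 3) + b * (3 * A * b\<^sup>2) + b * (3 * A * b\<^sup>2))) UNIV"
    by (rule has_sum_mult_mod_3[OF f0 f1 f2]) auto
  ultimately have "\<phi> (q ^ 3) ^ 4 = A * (A ^ 3 + 2 * b ^ 3) + b * (3 * A * b\<^sup>2) + b * (3 * A * b\<^sup>2)"
    by (rule has_sum_unique)
  also have "\<dots> = A ^ 4 + A * (\<phi> q - A) ^ 3"
    unfolding \<phi>q by (simp add: power4_eq_xxxx power3_eq_cube power2_eq_square algebra_simps)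
  finally show ?thesis by (simp add: A_def)
qed

section \<open>The inversion formula\<close>

text \<open>
  The reflection symmetry makes \<open>D\<close> a continuous function of \<open>cos (2 pi x)\<close>, so Weierstrass approximation
  applies without any need for sines.
\<close>

lemma zero_on_unit_interval_if_cos_moments_zero:
  fixes D :: "real \<Rightarrow> real"
  assumes cont: "continuous_on {0..1} D"
    and refl: "\<And>x. x \<in> {0..1} \<Longrightarrow> D (1 - x) = D x"
    and mom: "\<And>k::int. integral {0..1} (\<lambda>x. D x * cos (2 * pi * k * x)) = 0"
    and x: "x \<in> {0..1}"
  shows "D x = 0"
proof -
  let ?c = "\<lambda>x::real. cos (2 * pi * x)"
  have int: "(\<lambda>x. D x * f x) integrable_on {0..1}" if "continuous_on UNIV f" for f :: "real \<Rightarrow> real"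
    by (intro integrable_continuous_real continuous_intros cont continuous_on_subset[OF that]) auto
  have mom': "integral {0..1} (\<lambda>x. D x * (?c x ^ m * cos (2 * pi * k * x))) = 0" for m :: nat and k :: int
  proof (induction m arbitrary: k)
    case 0
    show ?case using mom[of k] by simp
  next
    case (Suc m)
    have *: "(\<lambda>x. D x * (?c x ^ Suc m * cos (2 * pi * k * x))) =
      (\<lambda>x. (D x * (?c x ^ m * cos (2 * pi * (k + 1) * x)) + D x * (?c x ^ m * cos (2 * pi * (k - 1) * x))) / 2)"
    proof
      fix x
      have "2 * (?c x * cos (2 * pi * k * x)) = cos (2 * pi * (k + 1) * x) + cos (2 * pi * (k - 1) * x)"
        unfolding cos_times_cos by (simp add: algebra_simps cos_diff cos_add)
      thus "D x * (?c x ^ Suc m * cos (2 * pi * k * x)) =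
        (D x * (?c x ^ m * cos (2 * pi * (k + 1) * x)) + D x * (?c x ^ m * cos (2 * pi * (k - 1) * x))) / 2"
        by (simp add: distrib_left[symmetric])
    qed
    have "integral {0..1} (\<lambda>x. D x * (?c x ^ m * cos (2 * pi * (k + 1) * x))
        + D x * (?c x ^ m * cos (2 * pi * (k - 1) * x)))
      = integral {0..1} (\<lambda>x. D x * (?c x ^ m * cos (2 * pi * of_int (k + 1) * x)))
        + integral {0..1} (\<lambda>x. D x * (?c x ^ m * cos (2 * pi * of_int (k - 1) * x)))"
      by (subst Henstock_Kurzweil_Integration.integral_add[symmetric]) (auto intro!: int continuous_intros)
    thus ?case unfolding * using Suc.IH[of "k + 1"] Suc.IH[of "k - 1"] by simp
  qed
  have poly: "integral {0..1} (\<lambda>x. D x * p (?c x)) = 0" if rp: "real_polynomial_function p" for p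
  proof -
    obtain a n where p: "p = (\<lambda>x. \<Sum>i\<le>n. a i * x ^ i)"
      using rp unfolding real_polynomial_function_iff_sum by (elim exE)
    have "integral {0..1} (\<lambda>x. D x * p (?c x)) = integral {0..1} (\<lambda>x. \<Sum>i\<le>n. a i * (D x * ?c x ^ i))"
      unfolding p by (simp add: sum_distrib_left mult_ac)
    also have "\<dots> = (\<Sum>i\<le>n. integral {0..1} (\<lambda>x. a i * (D x * ?c x ^ i)))"
      by (intro Henstock_Kurzweil_Integration.integral_sum finite_atMost integrable_on_mult_right int continuous_intros)
    also have "\<dots> = 0"
      using mom'[of _ 0] by simp
    finally show ?thesis .
  qed
  define g where "g u = D (arccos u / (2 * pi))" for u
  have gD: "g (?c x) = D x" if "x \<in> {0..1}" for x
  proof (cases "x \<le> 1 / 2")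
    case True
    hence "arccos (?c x) = 2 * pi * x"
      using that by (intro arccos_cos) (auto simp: field_simps)
    thus ?thesis by (simp add: g_def)
  next
    case False
    have "?c x = cos (2 * pi * (1 - x))"
      by (simp add: algebra_simps cos_diff)
    also have "arccos \<dots> = 2 * pi * (1 - x)"
      using False that by (intro arccos_cos) (auto simp: field_simps)
    finally show ?thesis using refl[OF that] by (simp add: g_def)
  qed
  have gcont: "continuous_on {-1..1} g"
    unfolding g_def
  proof (rule continuous_on_compose2[OF cont])
    show "continuous_on {-1..1} (\<lambda>u. arccos u / (2 * pi))"
      by (intro continuous_intros) auto
    show "(\<lambda>u. arccos u / (2 * pi)) ` {-1..1} \<subseteq> {0..1}"
      using arccos_lbound arccos_ubound by (force simp: field_simps)
  qed
  have Dint: "(\<lambda>x. (D x)\<^sup>2) integrable_on {0..1}" "(\<lambda>x. \<bar>D x\<bar>) integrable_on {0..1}"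
    by (intro integrable_continuous_real continuous_intros cont)+
  define C where "C = integral {0..1} (\<lambda>x. \<bar>D x\<bar>)"
  have le: "integral {0..1} (\<lambda>x. (D x)\<^sup>2) \<le> e * C" if e: "e > 0" for e
  proof -
    obtain p where p: "real_polynomial_function p" "\<And>u. u \<in> {-1..1} \<Longrightarrow> \<bar>g u - p u\<bar> < e"
      using Stone_Weierstrass_real_polynomial_function[OF compact_Icc gcont e] by blast
    have "continuous_on UNIV p"
      using p(1) by (simp add: real_polynomial_function_eq continuous_on_polymonial_function)
    hence "continuous_on UNIV (\<lambda>x. p (?c x))"
      by (rule continuous_on_compose2) (auto intro!: continuous_intros)
    hence pint: "(\<lambda>x. D x * p (?c x)) integrable_on {0..1}"
      by (rule int)
    have "integral {0..1} (\<lambda>x. (D x)\<^sup>2) = integral {0..1} (\<lambda>x. (D x)\<^sup>2 - D x * p (?c x))"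
      by (subst Henstock_Kurzweil_Integration.integral_diff) (simp_all add: Dint pint poly p)
    also have "\<dots> \<le> integral {0..1} (\<lambda>x. e * \<bar>D x\<bar>)"
    proof (rule integral_le)
      show "(\<lambda>x. (D x)\<^sup>2 - D x * p (?c x)) integrable_on {0..1}"
        by (intro integrable_diff Dint pint)
      show "(\<lambda>x. e * \<bar>D x\<bar>) integrable_on {0..1}"
        by (intro integrable_on_mult_right Dint)
      fix x :: real assume x: "x \<in> {0..1}"
      have "(D x)\<^sup>2 - D x * p (?c x) = D x * (g (?c x) - p (?c x))"
        using gD[OF x] by (simp add: power2_eq_square algebra_simps)
      also have "\<dots> \<le> \<bar>D x\<bar> * \<bar>g (?c x) - p (?c x)\<bar>"
        by (metis abs_ge_self abs_mult)
      also have "\<dots> \<le> \<bar>D x\<bar> * e"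
        using p(2)[of "?c x"] by (intro mult_left_mono) auto
      finally show "(D x)\<^sup>2 - D x * p (?c x) \<le> e * \<bar>D x\<bar>" by (simp add: mult.commute)
    qed
    also have "\<dots> = e * C" by (simp add: C_def)
    finally show ?thesis .
  qed
  have "C \<ge> 0" unfolding C_def by (rule Henstock_Kurzweil_Integration.integral_nonneg[OF Dint(2)]) simp
  have "integral {0..1} (\<lambda>x. (D x)\<^sup>2) \<le> 0"
  proof (rule field_le_epsilon)
    fix e :: real assume "e > 0"
    with \<open>C \<ge> 0\<close> have "e / (C + 1) * C \<le> e" "e / (C + 1) > 0"
      by (auto simp: field_simps)
    with le[of "e / (C + 1)"] show "integral {0..1} (\<lambda>x. (D x)\<^sup>2) \<le> 0 + e" by simp
  qed
  moreover have "integral {0..1} (\<lambda>x. (D x)\<^sup>2) \<ge> 0"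
    by (rule Henstock_Kurzweil_Integration.integral_nonneg[OF Dint(1)]) simp
  ultimately have "integral {0..1} (\<lambda>x. (D x)\<^sup>2) = 0" by simp
  hence "\<forall>x\<in>{0..1}. (D x)\<^sup>2 = 0"
    by (subst (asm) integral_eq_0_iff) (auto intro!: continuous_intros cont)
  thus ?thesis using x by simp
qed

lemma infsum_integrate_termwise:
  fixes f :: "'a \<Rightarrow> real \<Rightarrow> real"
  assumes cont: "\<And>n. continuous_on {a..b} (f n)"
    and le: "\<And>n x. x \<in> {a..b} \<Longrightarrow> \<bar>f n x\<bar> \<le> M n" and M: "M summable_on UNIV"
  shows "continuous_on {a..b} (\<lambda>x. \<Sum>\<^sub>\<infinity>n. f n x)"
    and "((\<lambda>n. integral {a..b} (f n)) has_sum integral {a..b} (\<lambda>x. \<Sum>\<^sub>\<infinity>n. f n x)) UNIV"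
proof -
  have lim: "uniform_limit {a..b} (\<lambda>X x. \<Sum>n\<in>X. f n x) (\<lambda>x. \<Sum>\<^sub>\<infinity>n. f n x) (finite_subsets_at_top UNIV)"
    by (rule Weierstrass_m_test_general[OF _ M]) (use le in auto)
  have c: "continuous_on {a..b} (\<lambda>x. \<Sum>n\<in>X. f n x)" for X
    by (intro continuous_intros cont)
  show "continuous_on {a..b} (\<lambda>x. \<Sum>\<^sub>\<infinity>n. f n x)"
    by (rule uniform_limit_theorem[OF _ lim]) (auto simp: c)
  obtain I J where I: "\<And>X. ((\<lambda>x. \<Sum>n\<in>X. f n x) has_integral I X) {a..b}"
    and J: "((\<lambda>x. \<Sum>\<^sub>\<infinity>n. f n x) has_integral J) {a..b}"
    and IJ: "(I \<longlongrightarrow> J) (finite_subsets_at_top UNIV)"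
    using uniform_limit_integral[OF lim c] by (metis finite_subsets_at_top_neq_bot)
  have "(\<Sum>n\<in>X. integral {a..b} (f n)) = I X" if "finite X" for X
    using integral_unique[OF I[of X]] that
    by (subst Henstock_Kurzweil_Integration.integral_sum[symmetric]) (auto intro!: integrable_continuous_real cont)
  hence "\<forall>\<^sub>F X in finite_subsets_at_top UNIV. I X = (\<Sum>n\<in>X. integral {a..b} (f n))"
    by (auto intro!: eventually_finite_subsets_at_top_weakI)
  with IJ have "(sum (\<lambda>n. integral {a..b} (f n)) \<longlongrightarrow> J) (finite_subsets_at_top UNIV)"
    by (rule Lim_transform_eventually)
  thus "((\<lambda>n. integral {a..b} (f n)) has_sum integral {a..b} (\<lambda>x. \<Sum>\<^sub>\<infinity>n. f n x)) UNIV"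
    using integral_unique[OF J] by (simp add: has_sum_def)
qed

lemma gaussian_cos_integral:
  fixes t s :: real
  assumes t: "t > 0"
  shows "integrable lborel (\<lambda>x. exp (- pi * t * x\<^sup>2) * cos (2 * pi * s * x))"
    and "(LBINT x. exp (- pi * t * x\<^sup>2) * cos (2 * pi * s * x)) = exp (- pi * s\<^sup>2 / t) / sqrt t"
proof -
  define r where "r = sqrt (2 * pi * t)"
  define w where "w = 2 * pi * s / r"
  have r: "r > 0" "r\<^sup>2 = 2 * pi * t" using t by (simp_all add: r_def)
  interpret real_distribution std_normal_distribution
    by (rule real_dist_normal_dist)
  have int: "integrable std_normal_distribution (\<lambda>x. iexp (w * x))"
    by (rule integrable_iexp) auto
  have "complex_of_real (exp (- w\<^sup>2 / 2)) = (CLINT x|std_normal_distribution. iexp (w * x))"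
    using fun_cong[OF char_std_normal_distribution, of w] by (simp add: char_def)
  hence "exp (- w\<^sup>2 / 2) = Re (CLINT x|std_normal_distribution. iexp (w * x))"
    by (metis Re_complex_of_real)
  also have "\<dots> = (LINT x|std_normal_distribution. Re (iexp (w * x)))"
    by (rule integral_Re[OF int, symmetric])
  also have "\<dots> = (LINT x|std_normal_distribution. cos (w * x))"
    by (simp add: Re_exp)
  finally have "(LINT x|std_normal_distribution. cos (w * x)) = exp (- w\<^sup>2 / 2)" ..
  moreover have "integrable std_normal_distribution (\<lambda>x. Re (iexp (w * x)))"
    by (rule integrable_Re[OF int])
  hence "integrable std_normal_distribution (\<lambda>x. cos (w * x))"
    by (simp add: Re_exp)
  ultimately have "has_bochner_integral lborel (\<lambda>x. std_normal_density x * cos (w * x)) (exp (- w\<^sup>2 / 2))"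
    by (simp add: has_bochner_integral_iff integrable_real_density integral_real_density)
  hence "has_bochner_integral lborel (\<lambda>x. std_normal_density (0 + r * x) * cos (w * (0 + r * x)))
      (exp (- w\<^sup>2 / 2) /\<^sub>R \<bar>r\<bar>)"
    using r by (subst (asm) lborel_has_bochner_integral_real_affine_iff[of r _ _ 0]) simp_all
  hence "has_bochner_integral lborel (\<lambda>x. sqrt (2 * pi) * (std_normal_density (0 + r * x) * cos (w * (0 + r * x))))
      (sqrt (2 * pi) * (exp (- w\<^sup>2 / 2) /\<^sub>R \<bar>r\<bar>))"
    by (rule has_bochner_integral_mult_right)
  also have "(\<lambda>x. sqrt (2 * pi) * (std_normal_density (0 + r * x) * cos (w * (0 + r * x))))
      = (\<lambda>x. exp (- pi * t * x\<^sup>2) * cos (2 * pi * s * x))"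
    using r by (auto simp: std_normal_density_def w_def power_mult_distrib fun_eq_iff mult.assoc)
  also have "sqrt (2 * pi) * (exp (- w\<^sup>2 / 2) /\<^sub>R \<bar>r\<bar>) = exp (- pi * s\<^sup>2 / t) / sqrt t"
  proof -
    have "w\<^sup>2 / 2 = pi * s\<^sup>2 / t"
      using r t by (simp add: w_def power_divide power_mult_distrib power2_eq_square)
    thus ?thesis using r(1) t by (simp add: r_def real_sqrt_mult divide_simps)
  qed
  finally show "integrable lborel (\<lambda>x. exp (- pi * t * x\<^sup>2) * cos (2 * pi * s * x))"
    "(LBINT x. exp (- pi * t * x\<^sup>2) * cos (2 * pi * s * x)) = exp (- pi * s\<^sup>2 / t) / sqrt t"
    by (simp_all add: has_bochner_integral_iff)
qed

lemma integral_eq_sum_of_translates: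
  fixes h :: "real \<Rightarrow> real"
  assumes cont: "continuous_on UNIV h" and int: "integrable lborel h"
    and sum: "((\<lambda>n::int. integral {0..1} (\<lambda>x. h (x + n))) has_sum S) UNIV"
  shows "S = (LBINT x. h x)"
proof -
  have shift: "integral {0..1} (\<lambda>x. h (x + of_int n)) = integral {of_int n..of_int n + 1} h" for n
    using integral_shift_real_ivl[where a = "of_int n" and b = "of_int n + 1" and c = "of_int n" and f = h]
    by simp
  have h: "h integrable_on {a..b}" for a b
    by (intro integrable_continuous_real continuous_on_subset[OF cont]) auto
  have partial: "(\<Sum>n\<in>{-int N..<int N}. integral {0..1} (\<lambda>x. h (x + of_int n))) = integral {-real N..real N} h" for N
  proof (induction N)
    case (Suc N)
    have "{- int (Suc N)..<int (Suc N)} = insert (- int N - 1) (insert (int N) {- int N..<int N})"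
      by auto
    hence "(\<Sum>n\<in>{- int (Suc N)..<int (Suc N)}. integral {0..1} (\<lambda>x. h (x + of_int n)))
      = integral {- real N - 1..- real N} h + (integral {real N..real N + 1} h + integral {- real N..real N} h)"
      using Suc.IH shift[of "int N"] shift[of "- int N - 1"] by simp
    also have "integral {real N..real N + 1} h + integral {- real N..real N} h = integral {- real N..real N + 1} h"
      using Henstock_Kurzweil_Integration.integral_combine[of "- real N" "real N" "real N + 1" h] h by simp
    also have "integral {- real N - 1..- real N} h + \<dots> = integral {- real N - 1..real N + 1} h"
      by (rule Henstock_Kurzweil_Integration.integral_combine) (simp_all add: h)
    also have "{- real N - 1..real N + 1} = {- real (Suc N)..real (Suc N)}" by auto
    finally show ?case .
  qed simp
  have "filterlim (\<lambda>N. {-int N..<int N}) (finite_subsets_at_top UNIV) sequentially"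
    unfolding filterlim_finite_subsets_at_top
  proof safe
    fix X :: "int set" assume "finite X"
    hence K: "\<bar>x\<bar> \<le> Max (abs ` X)" if "x \<in> X" for x
      using that by (intro Max_ge) auto
    show "\<forall>\<^sub>F N in sequentially. finite {-int N..<int N} \<and> X \<subseteq> {-int N..<int N} \<and> {-int N..<int N} \<subseteq> UNIV"
    proof (rule eventually_sequentiallyI[of "nat (Max (abs ` X)) + 1"], safe)
      fix N x assume "nat (Max (abs ` X)) + 1 \<le> N" "x \<in> X"
      thus "x \<in> {-int N..<int N}" using K[of x] by auto
    qed auto
  qed
  with sum have "(\<lambda>N. \<Sum>n\<in>{-int N..<int N}. integral {0..1} (\<lambda>x. h (x + of_int n))) \<longlonglongrightarrow> S"
    unfolding has_sum_def by (rule filterlim_compose)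
  hence "(\<lambda>N. integral {-real N..real N} h) \<longlonglongrightarrow> S"
    by (simp add: partial)
  moreover have "(\<lambda>N. integral {-real N..real N} h) \<longlonglongrightarrow> (LBINT x. h x)"
  proof -
    have "(\<lambda>N. LBINT x. indicator {-real N..real N} x *\<^sub>R h x) \<longlonglongrightarrow> (LBINT x. h x)"
    proof (rule integral_dominated_convergence)
      show "integrable lborel (\<lambda>x. norm (h x))" using int by (rule integrable_norm)
      show "AE x in lborel. (\<lambda>N. indicator {-real N..real N} x *\<^sub>R h x) \<longlonglongrightarrow> h x"
      proof
        fix x :: real
        have "eventually (\<lambda>N. \<bar>x\<bar> \<le> real N) sequentially"
          by (rule filterlim_real_sequentially[unfolded filterlim_at_top, rule_format])
        hence "eventually (\<lambda>N. indicator {-real N..real N} x *\<^sub>R h x = h x) sequentially"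
          by eventually_elim (auto simp: indicator_def)
        thus "(\<lambda>N. indicator {-real N..real N} x *\<^sub>R h x) \<longlonglongrightarrow> h x"
          by (rule tendsto_eventually)
      qed
    qed (use int in \<open>auto split: split_indicator\<close>)
    moreover have "(LBINT x. indicator {-real N..real N} x *\<^sub>R h x) = integral {-real N..real N} h" for N
    proof -
      have "set_integrable lborel {-real N..real N} h"
        unfolding set_integrable_def by (rule integrable_mult_indicator[OF _ int]) simp
      from set_borel_integral_eq_integral(2)[OF this] show ?thesis
        by (simp add: set_lebesgue_integral_def)
    qed
    ultimately show ?thesis by simp
  qed
  ultimately show ?thesis by (rule LIMSEQ_unique)
qed

lemma integral_cos_2pi:
  fixes k :: int
  shows "integral {0..1} (\<lambda>x. cos (2 * pi * k * x)) = of_bool (k = 0)"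
proof (cases "k = 0")
  case False
  have "((\<lambda>x. cos (2 * pi * k * x)) has_integral
      (sin (2 * pi * k * 1) / (2 * pi * k) - sin (2 * pi * k * 0) / (2 * pi * k))) {0..1}"
    by (rule fundamental_theorem_of_calculus)
       (use False in \<open>auto intro!: derivative_eq_intros simp: has_real_derivative_iff_has_vector_derivative[symmetric]\<close>)
  thus ?thesis using False sin_int_2pin[of k] by (simp add: integral_unique)
qed simp

lemma poisson_summation_gaussian:
  fixes t :: real
  assumes t: "t > 0"
  defines "c \<equiv> \<lambda>m::int. exp (- pi * m\<^sup>2 / t) / sqrt t"
  assumes x: "x \<in> {0..1}"
  shows "(\<Sum>\<^sub>\<infinity>n::int. exp (- pi * t * (x + n)\<^sup>2)) = (\<Sum>\<^sub>\<infinity>m::int. c m * cos (2 * pi * m * x))"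
proof -
  define M where "M n = exp (pi * t) * exp (- pi * t / 2) powi n\<^sup>2" for n :: int
  have M: "M summable_on UNIV"
    unfolding M_def using t by (intro summable_on_cmult_right summable_on_powi_square) auto
  have M_le: "exp (- pi * t * (x + n)\<^sup>2) \<le> M n" if "x \<in> {0..1}" for x :: real and n :: int
  proof -
    have "0 \<le> (n + 2 * x)\<^sup>2" by simp
    moreover have "x\<^sup>2 \<le> 1" using that by (simp add: power_le_one)
    ultimately have "(real_of_int n)\<^sup>2 \<le> 2 * (x + n)\<^sup>2 + 2"
      by (simp add: power2_eq_square algebra_simps)
    hence "pi * t * (real_of_int n)\<^sup>2 \<le> pi * t * (2 * (x + n)\<^sup>2 + 2)"
      using t by (intro mult_left_mono) auto
    thus ?thesis
      by (simp add: M_def exp_power_int exp_add[symmetric] algebra_simps)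
  qed
  have c_eq: "c = (\<lambda>m. exp (- pi / t) powi m\<^sup>2 * inverse (sqrt t))"
    by (simp add: c_def exp_power_int mult_ac divide_inverse)
  have c: "c summable_on UNIV"
    unfolding c_eq using t by (intro summable_on_cmult_left summable_on_powi_square) auto
  have c_pos: "c m \<ge> 0" for m using t by (simp add: c_def)

  define F where "F = (\<lambda>x. \<Sum>\<^sub>\<infinity>n::int. exp (- pi * t * (x + n)\<^sup>2))"
  define G where "G = (\<lambda>x. \<Sum>\<^sub>\<infinity>m::int. c m * cos (2 * pi * m * x))"
  have F_cont: "continuous_on {0..1} F"
    unfolding F_def by (rule infsum_integrate_termwise(1)[OF _ _ M]) (use M_le in \<open>auto intro!: continuous_intros\<close>)
  have G_cont: "continuous_on {0..1} G"
    unfolding G_def by (rule infsum_integrate_termwise(1)[OF _ _ c])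
      (auto intro!: continuous_intros mult_left_le simp: abs_mult c_pos)
  have F_mom: "integral {0..1} (\<lambda>x. F x * cos (2 * pi * k * x)) = c k" for k :: int
  proof -
    define h where "h y = exp (- pi * t * y\<^sup>2) * cos (2 * pi * k * y)" for y :: real
    have h: "h (x + n) = exp (- pi * t * (x + n)\<^sup>2) * cos (2 * pi * k * x)" for x :: real and n :: int
    proof -
      have "cos (2 * pi * k * (x + n)) = cos (2 * pi * k * x + 2 * pi * of_int (k * n))"
        by (simp add: algebra_simps)
      also have "\<dots> = cos (2 * pi * k * x)"
        by (simp add: cos_add del: of_int_mult)
      finally show ?thesis by (simp add: h_def)
    qed
    have "((\<lambda>n::int. integral {0..1} (\<lambda>x. h (x + n))) has_sum
        integral {0..1} (\<lambda>x. \<Sum>\<^sub>\<infinity>n::int. h (x + n))) UNIV"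
    proof (rule infsum_integrate_termwise(2)[OF _ _ M])
      show "continuous_on {0..1} (\<lambda>x. h (x + real_of_int n))" for n
        unfolding h_def by (intro continuous_intros)
      show "\<bar>h (x + real_of_int n)\<bar> \<le> M n" if "x \<in> {0..1}" for n x
        unfolding h abs_mult using M_le[OF that, of n]
        by (intro order.trans[OF mult_left_le]) auto
    qed
    hence "integral {0..1} (\<lambda>x. \<Sum>\<^sub>\<infinity>n::int. h (x + n)) = (LBINT y. h y)"
      by (rule integral_eq_sum_of_translates[rotated 2])
         (use gaussian_cos_integral(1)[OF t] in \<open>auto simp: h_def intro!: continuous_intros\<close>)
    also have "\<dots> = c k"
      unfolding h_def c_def by (rule gaussian_cos_integral(2)[OF t])
    finally show ?thesis
      by (simp add: h infsum_cmult_left' F_def)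
  qed
  have G_mom: "integral {0..1} (\<lambda>x. G x * cos (2 * pi * k * x)) = c k" for k :: int
  proof -
    have int: "integral {0..1} (\<lambda>x. c m * cos (2 * pi * m * x) * cos (2 * pi * k * x))
        = c m * of_bool (m = k) / 2 + c m * of_bool (m = - k) / 2" for m :: int
    proof -
      have *: "(\<lambda>x. c m * cos (2 * pi * m * x) * cos (2 * pi * k * x)) =
        (\<lambda>x. c m / 2 * (cos (2 * pi * of_int (m - k) * x) + cos (2 * pi * of_int (m + k) * x)))"
      proof
        fix x :: real
        have "cos (2 * pi * of_int (m - k) * x) + cos (2 * pi * of_int (m + k) * x)
          = 2 * (cos (2 * pi * m * x) * cos (2 * pi * k * x))"
          by (simp add: algebra_simps cos_add cos_diff)
        thus "c m * cos (2 * pi * m * x) * cos (2 * pi * k * x)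
          = c m / 2 * (cos (2 * pi * of_int (m - k) * x) + cos (2 * pi * of_int (m + k) * x))"
          by simp
      qed
      have "integral {0..1} (\<lambda>x. cos (2 * pi * of_int (m - k) * x) + cos (2 * pi * of_int (m + k) * x))
        = of_bool (m - k = 0) + of_bool (m + k = 0)"
        by (subst Henstock_Kurzweil_Integration.integral_add)
           (simp_all only: integral_cos_2pi, auto intro!: integrable_continuous_real continuous_intros)
      moreover have "m - k = 0 \<longleftrightarrow> m = k" "m + k = 0 \<longleftrightarrow> m = - k" by auto
      ultimately show ?thesis
        by (simp only: * Henstock_Kurzweil_Integration.integral_mult_right) (simp add: distrib_left)
    qed
    have "((\<lambda>m. integral {0..1} (\<lambda>x. c m * cos (2 * pi * m * x) * cos (2 * pi * k * x))) has_sum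
        integral {0..1} (\<lambda>x. \<Sum>\<^sub>\<infinity>m::int. c m * cos (2 * pi * m * x) * cos (2 * pi * k * x))) UNIV"
    proof (rule infsum_integrate_termwise(2)[OF _ _ c])
      show "continuous_on {0..1} (\<lambda>x. c m * cos (2 * pi * m * x) * cos (2 * pi * k * x))" for m
        by (intro continuous_intros)
      show "\<bar>c m * cos (2 * pi * m * x) * cos (2 * pi * k * x)\<bar> \<le> c m" for m x
        using mult_left_le[OF _ c_pos[of m], of "\<bar>cos (2 * pi * m * x) * cos (2 * pi * k * x)\<bar>"] c_pos[of m]
        by (simp add: abs_mult mult_le_one mult.assoc)
    qed
    moreover have "((\<lambda>m. c m * of_bool (m = k) / 2 + c m * of_bool (m = - k) / 2) has_sum (c k / 2 + c (- k) / 2)) UNIV"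
      by (intro has_sum_add has_sum_finite_neutralI[of "{k}"] has_sum_finite_neutralI[of "{- k}"]) auto
    ultimately have "integral {0..1} (\<lambda>x. \<Sum>\<^sub>\<infinity>m::int. c m * cos (2 * pi * m * x) * cos (2 * pi * k * x))
        = c k / 2 + c (- k) / 2"
      unfolding int by (rule has_sum_unique)
    also have "\<dots> = c k" by (simp add: c_def)
    finally show ?thesis by (simp add: infsum_cmult_left' G_def)
  qed
  have "F x - G x = 0"
  proof (rule zero_on_unit_interval_if_cos_moments_zero[OF _ _ _ x])
    show "continuous_on {0..1} (\<lambda>x. F x - G x)"
      by (intro continuous_intros F_cont G_cont)
    show "F (1 - x) - G (1 - x) = F x - G x" for x
    proof -
      have "F (1 - x) = F x"
        unfolding F_def
        by (rule infsum_reindex_bij_witness[of _ "\<lambda>n. - n - 1" "\<lambda>n. - n - 1"])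
           (auto simp: power2_eq_square algebra_simps)
      moreover have "cos (2 * pi * of_int m * (1 - x)) = cos (2 * pi * of_int m * x)" for m :: int
        using cos_int_2pin[of m] sin_int_2pin[of m] by (simp add: right_diff_distrib cos_diff)
      hence "G (1 - x) = G x" by (simp add: G_def)
      ultimately show ?thesis by simp
    qed
    show "integral {0..1} (\<lambda>x. (F x - G x) * cos (2 * pi * of_int k * x)) = 0" for k
      unfolding left_diff_distrib
      by (subst Henstock_Kurzweil_Integration.integral_diff)
         (auto simp: F_mom G_mom intro!: integrable_continuous_real continuous_intros F_cont G_cont)
  qed
  thus ?thesis by (simp add: F_def G_def)
qed

lemma ramanujan_phi_inversion:
  fixes t :: real
  assumes t: "t > 0"
  shows "\<phi> (exp (- pi * t)) = \<phi> (exp (- pi / t)) / sqrt t"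
proof -
  have "(\<Sum>\<^sub>\<infinity>n::int. exp (- pi * t * (0 + n)\<^sup>2)) = (\<Sum>\<^sub>\<infinity>m::int. exp (- pi * m\<^sup>2 / t) / sqrt t * cos (2 * pi * m * 0))"
    by (rule poisson_summation_gaussian[OF t]) simp
  also have "\<dots> = (\<Sum>\<^sub>\<infinity>m::int. exp (- pi * m\<^sup>2 / t)) / sqrt t"
    by (simp add: divide_inverse infsum_cmult_left')
  finally show ?thesis
    by (simp add: ramanujan_phi_def exp_power_int mult_ac)
qed

section \<open>The quotient\<close>

lemma ramanujan_phi_pos:
  fixes q :: real
  assumes "0 < q" "q < 1"
  shows "\<phi> q > 0"
proof -
  have "((\<lambda>n::int. q powi n\<^sup>2) has_sum 1) {0}"
    by (rule has_sum_finiteI) auto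
  from has_sum_mono'[OF this has_sum_ramanujan_phi[OF assms]] have "1 \<le> \<phi> q"
    using assms by simp
  thus ?thesis by simp
qed

theorem theorem4p10:
  fixes p a :: real
  assumes p_def: "p = 2 * (2 powr (1/3) - 1)\<^sup>2"
    and a_def: "a = 2 * (2 powr (2/3) - 1) powr (1/2)"
  shows "\<phi> (exp (- 9 * pi * sqrt 3)) / \<phi> (exp (- 3 * pi * sqrt 3))
    = 3 powr (- 5/4) *
        (1 + root 3 (p * ((1 - a * sin (pi/9)) / (1 - a * sin (2*pi/9))))
           + root 3 (p * ((1 + a * sin (4*pi/9)) / (1 - a * sin (pi/9))))
           + (2 powr (2/3) - 2 powr (1/3))
           + root 3 (p * ((1 - a * sin (2*pi/9)) / (1 + a * sin (4*pi/9)))))"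
proof -
  define c :: real where "c = 2 powr (1/3)"
  define s :: real where "s = sqrt 3"
  define r :: real where "r = sqrt s"
  define g where "g = root 3 (2 / (c - 1))"
  define h where "h t = \<phi> (exp (- pi * t))" for t :: real
  have c3: "c ^ 3 = 2" and c2: "c\<^sup>2 = 2 powr (2/3)"
    by (simp_all add: c_def powr_power)
  have c1: "c > 1"
    by (simp add: c_def)
  have s: "s > 0" "s * s = 3" by (simp_all add: s_def)
  have r: "r > 0" "r * r = s" using s by (simp_all add: r_def)
  have r4: "r ^ 4 = 3"
  proof -
    have "r ^ 4 = (r * r) * (r * r)" by (simp add: power4_eq_xxxx)
    thus ?thesis by (simp only: r(2) s(2))
  qed
  have g3: "g ^ 3 = 2 * (1 + c + c\<^sup>2)"
  proof -
    have "g ^ 3 = 2 / (c - 1)" using c1 by (simp add: g_def)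
    also have "\<dots> = 2 * (1 + c + c\<^sup>2)"
      using c1 c3 by (simp add: divide_eq_eq algebra_simps power2_eq_square power3_eq_cube)
    finally show ?thesis .
  qed

  have inv: "h (1 / t) = sqrt t * h t" if "t > 0" for t
    using ramanujan_phi_inversion[OF that] that by (simp add: h_def)
  have cubic: "h (3 * t) ^ 4 = h (9 * t) ^ 4 + h (9 * t) * (h t - h (9 * t)) ^ 3" if "t > 0" for t
    using ramanujan_phi_cubic[of "exp (- pi * t)"] that
    by (simp add: h_def exp_of_nat_mult[symmetric] mult_ac)
  have cube_inj: "x = y" if "x ^ 3 = y ^ 3" for x y :: real
    using that by (metis odd_numeral odd_real_root_power_cancel)

  define H where "H = h s"
  define Y where "Y = h (1 / (3 * s))"
  define Z where "Z = h (1 / (9 * s))"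
  have H: "H > 0" unfolding H_def h_def using s by (intro ramanujan_phi_pos) auto
  have h1: "h (1 / s) = r * H" using inv[of s] s by (simp add: r_def H_def)
  have Y: "Y = r ^ 3 * h (3 * s)"
  proof -
    have "(r ^ 3)\<^sup>2 = r ^ 4 * (r * r)" by (simp add: power2_eq_square power3_eq_cube power4_eq_xxxx)
    also have "\<dots> = 3 * s" using r4 r(2) by simp
    finally have "sqrt (3 * s) = r ^ 3" using r(1) by (intro real_sqrt_unique) auto
    thus ?thesis using inv[of "3 * s"] s by (simp add: Y_def)
  qed
  have Z: "Z = 3 * r * h (9 * s)"
  proof -
    have "sqrt 9 = (3 :: real)" by (rule real_sqrt_unique) auto
    hence "sqrt (9 * s) = 3 * r" by (simp add: r_def real_sqrt_mult)
    thus ?thesis using inv[of "9 * s"] s by (simp add: Z_def)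
  qed
  have YH: "Y = (1 + c) * H"
  proof -
    have "3 / s = s" using s by (simp add: field_simps)
    hence "(r * H) ^ 4 = H ^ 4 + H * (Y - H) ^ 3"
      using cubic[of "1 / (3 * s)"] s h1 by (simp add: Y_def H_def)
    hence "H * (Y - H) ^ 3 = 2 * H ^ 4"
      by (simp add: power_mult_distrib r4)
    also have "\<dots> = H * (c * H) ^ 3"
      unfolding power_mult_distrib c3 by (simp add: power4_eq_xxxx power3_eq_cube)
    finally have "(Y - H) ^ 3 = (c * H) ^ 3" using H by simp
    hence "Y - H = c * H" by (rule cube_inj)
    thus ?thesis by (simp add: algebra_simps)
  qed
  have ZH: "Z = (1 + g) * (r * H)"
  proof -
    have "Y ^ 4 = (r * H) ^ 4 + (r * H) * (Z - r * H) ^ 3"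
      using cubic[of "1 / (9 * s)"] s h1 by (simp add: Y_def Z_def)
    hence "(r * H) * (Z - r * H) ^ 3 = ((1 + c) ^ 4 - 3) * H ^ 4"
      by (simp add: YH power_mult_distrib r4 left_diff_distrib)
    also have "(1 + c) ^ 4 - 3 = 3 * g ^ 3"
      unfolding g3 using c3 by (simp add: power2_eq_square power3_eq_cube power4_eq_xxxx algebra_simps)
    also have "3 * g ^ 3 * H ^ 4 = (r * H) * (g * (r * H)) ^ 3"
      unfolding r4[symmetric] by (simp add: power_mult_distrib power4_eq_xxxx power3_eq_cube)
    finally have "(Z - r * H) ^ 3 = (g * (r * H)) ^ 3" using H r by simp
    hence "Z - r * H = g * (r * H)" by (rule cube_inj)
    thus ?thesis by (simp add: algebra_simps)
  qed

  have "h (9 * s) / h (3 * s) = (Z / (3 * r)) / (Y / r ^ 3)"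
    using r by (simp add: Y Z)
  also have "\<dots> = r ^ 4 * (1 + g) / (3 * r * (1 + c))"
  proof -
    have "Z / (3 * r) / (Y / r ^ 3) = H * (r ^ 4 * (1 + g)) / (H * (3 * r * (1 + c)))"
      unfolding YH ZH using H r(1) c1 by (simp add: power3_eq_cube power4_eq_xxxx mult_ac)
    thus ?thesis using H by simp
  qed
  also have "\<dots> = 1 / (3 * r) * ((1 - c + c\<^sup>2) * (1 + g))"
  proof -
    have "r ^ 4 = (1 - c + c\<^sup>2) * (1 + c)"
      using c3 r4 by (simp add: algebra_simps power2_eq_square power3_eq_cube)
    thus ?thesis using c1 r by simp
  qed
  also have "1 / (3 * r) = 3 powr (- 5/4)"
  proof -
    have "r = 3 powr (1/4)"
      by (simp add: r_def s_def powr_half_sqrt[symmetric] powr_powr)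
    hence "3 * r = 3 powr (5/4)"
      using powr_add[of 3 1 "1/4 :: real"] by simp
    thus ?thesis by (simp add: powr_minus_divide)
  qed
  finally have "h (9 * s) / h (3 * s) = 3 powr (- 5/4) * ((1 - c + c\<^sup>2) * (1 + g))" .
  moreover have "a = 2 * sqrt (c\<^sup>2 - 1)"
    unfolding a_def c2[symmetric] using c1 by (subst powr_half_sqrt) (auto simp: one_le_power)
  note radicals = sum_cube_roots_unit_ratios[OF c3 this p_def[folded c_def], folded g_def]
  have "(1 - c + c\<^sup>2) * (1 + g) = 1 + (1 - c + c\<^sup>2) * g + (c\<^sup>2 - c)"
    by (simp add: algebra_simps)
  note this[folded radicals]
  moreover have "exp (- 9 * pi * sqrt 3) = exp (- pi * (9 * s))" "exp (- 3 * pi * sqrt 3) = exp (- pi * (3 * s))"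
    by (simp_all add: s_def)
  ultimately show ?thesis
    unfolding c_def[symmetric] c2[symmetric] h_def by (simp add: add_ac mult_ac)
qed

end
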